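(* Let $(G,\oplus)$ be a Smarandache loop. (1) If every $f,g$-principal isotope of $(G,\oplus)$ is a Smarandache $f,g$-principal isotope of $(G,\oplus)$, then $(G,\oplus)$ is universal, i.e. every loop isotopic to $(G,\oplus)$ is a Smarandache loop. (2) Conversely, if $(G,\oplus)$ is a universal Smarandache loop, then there is an S-subloop $(S,\oplus)$ of $(G,\oplus)$ such that for all $f,g\in S$ the triple $$(I,\;L_fR_g^{-1}R_{f^\rho}L_f^{-1},\;R_g^{-1}R_{f^\rho})$$ is an autotopism of $(S,\oplus)$.
   Context: A Smarandache loop (S-loop) is a loop having at least one non-trivial (more than one element) subloop which is a group under the loop operation; such a subloop is called an S-subloop. A Smarandache loop is universal if every loop isotopic to it is a Smarandache loop. Loops $(G,\oplus)$ and $(H,\otimes)$ are isotopic if there are bijections $A,B,C:G\to H$ with $xA\otimes yB=(x\oplus y)C$ for all $x,y\in G$. Maps are written on the right of their arguments and composed from left to right. $I$ is the identity map, $xR_g=x\oplus g$, $yL_f=f\oplus y$. With $e$ the identity element, $f^\rho$ is defined by $f\oplus f^\rho=e$. An autotopism of $(S,\oplus)$ is a triple $(A,B,C)$ of bijections of $S$ with $xA\oplus yB=(x\oplus y)C$ for all $x,y\in S$; in such triples the translations are those of $(S,\oplus)$. For $f,g\in G$ the $f,g$-principal isotope of $(G,\oplus)$ is the loop $(G,\circ)$ with $xR_g\circ yL_f=x\oplus y$ for all $x,y\in G$. An $f,g$-principal isotope of $(G,\oplus)$ is any $(G,\circ)$ arising in this way from some $f,g\in G$. $(G,\circ)$ is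 a Smarandache $f,g$-principal isotope of $(G,\oplus)$ if there are an S-subloop $(S,\oplus)$ of $(G,\oplus)$ and elements $f,g\in S$ such that $xR_g\circ yL_f=x\oplus y$ for all $x,y\in G$; then $f,g$ are called S-elements. *)

theory Defs
  imports "HOL-Algebra.Group"
begin

text \<open>Left-to-right composition.\<close>
notation fcomp (infixl "\<circ>>" 60)

text \<open>
  Loops are carried by the record type of monoids, of which only the carrier, the multiplication
  and the unit are used; associativity is not assumed.
\<close>

locale loop =
  fixes G (structure)
  assumes m_closed: "\<lbrakk>x \<in> carrier G; y \<in> carrier G\<rbrakk> \<Longrightarrow> x \<otimes> y \<in> carrier G"
    and one_closed: "\<one> \<in> carrier G"
    and l_one: "x \<in> carrier G \<Longrightarrow> \<one> \<otimes> x = x"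
    and r_one: "x \<in> carrier G \<Longrightarrow> x \<otimes> \<one> = x"
    and right_solvable: "\<lbrakk>a \<in> carrier G; b \<in> carrier G\<rbrakk> \<Longrightarrow> \<exists>!x. x \<in> carrier G \<and> a \<otimes> x = b"
    and left_solvable: "\<lbrakk>a \<in> carrier G; b \<in> carrier G\<rbrakk> \<Longrightarrow> \<exists>!y. y \<in> carrier G \<and> y \<otimes> a = b"

definition right_trans :: "('a, 'm) monoid_scheme \<Rightarrow> 'a \<Rightarrow> 'a \<Rightarrow> 'a"
  where "right_trans G g = (\<lambda>x. x \<otimes>\<^bsub>G\<^esub> g)"

definition left_trans :: "('a, 'm) monoid_scheme \<Rightarrow> 'a \<Rightarrow> 'a \<Rightarrow> 'a"
  where "left_trans G f = (\<lambda>y. f \<otimes>\<^bsub>G\<^esub> y)"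

definition right_trans_inv :: "('a, 'm) monoid_scheme \<Rightarrow> 'a \<Rightarrow> 'a \<Rightarrow> 'a"
  where "right_trans_inv G g = inv_into (carrier G) (right_trans G g)"

definition left_trans_inv :: "('a, 'm) monoid_scheme \<Rightarrow> 'a \<Rightarrow> 'a \<Rightarrow> 'a"
  where "left_trans_inv G f = inv_into (carrier G) (left_trans G f)"

definition right_inverse :: "('a, 'm) monoid_scheme \<Rightarrow> 'a \<Rightarrow> 'a"
  where "right_inverse G f = (THE x. x \<in> carrier G \<and> f \<otimes>\<^bsub>G\<^esub> x = \<one>\<^bsub>G\<^esub>)"

definition isotopism ::
    "('a, 'm) monoid_scheme \<Rightarrow> ('b, 'n) monoid_scheme \<Rightarrow>
      ('a \<Rightarrow> 'b) \<Rightarrow> ('a \<Rightarrow> 'b) \<Rightarrow> ('a \<Rightarrow> 'b) \<Rightarrow> bool"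
  where "isotopism G H A B C \<longleftrightarrow>
    bij_betw A (carrier G) (carrier H) \<and>
    bij_betw B (carrier G) (carrier H) \<and>
    bij_betw C (carrier G) (carrier H) \<and>
    (\<forall>x\<in>carrier G. \<forall>y\<in>carrier G. A x \<otimes>\<^bsub>H\<^esub> B y = C (x \<otimes>\<^bsub>G\<^esub> y))"

definition isotopic :: "('a, 'm) monoid_scheme \<Rightarrow> ('b, 'n) monoid_scheme \<Rightarrow> bool"
  where "isotopic G H \<longleftrightarrow> (\<exists>A B C. isotopism G H A B C)"

definition autotopism ::
    "('a, 'm) monoid_scheme \<Rightarrow> ('a \<Rightarrow> 'a) \<Rightarrow> ('a \<Rightarrow> 'a) \<Rightarrow> ('a \<Rightarrow> 'a) \<Rightarrow> bool"
  where "autotopism G A B C \<longleftrightarrow> isotopism G G A B C"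

definition subloop :: "'a set \<Rightarrow> ('a, 'm) monoid_scheme \<Rightarrow> bool"
  where "subloop S G \<longleftrightarrow> S \<subseteq> carrier G \<and> loop (G\<lparr>carrier := S\<rparr>)"

definition S_subloop :: "'a set \<Rightarrow> ('a, 'm) monoid_scheme \<Rightarrow> bool"
  where "S_subloop S G \<longleftrightarrow>
    subloop S G \<and> (\<exists>x\<in>S. \<exists>y\<in>S. x \<noteq> y) \<and> group (G\<lparr>carrier := S\<rparr>)"

definition smarandache_loop :: "('a, 'm) monoid_scheme \<Rightarrow> bool"
  where "smarandache_loop G \<longleftrightarrow> loop G \<and> (\<exists>S. S_subloop S G)"

text \<open>
  A formula cannot quantify over types, so the type of the elements of the isotopes is passed as
  a parameter. The choice \<open>'b = 'a\<close> already covers every isotope of \<open>G\<close> up to isomorphism,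
  since an isotope is in bijection with the carrier of \<open>G\<close>.
\<close>

definition universal_smarandache_loop :: "'b itself \<Rightarrow> ('a, 'm) monoid_scheme \<Rightarrow> bool"
  where "universal_smarandache_loop TYPE('b) G \<longleftrightarrow>
    smarandache_loop G \<and>
    (\<forall>H :: 'b monoid. loop H \<and> isotopic G H \<longrightarrow> smarandache_loop H)"

text \<open>
  \<open>H\<close> is the \<open>f,g\<close>-principal isotope of \<open>G\<close>. This determines the multiplication of \<open>H\<close> only on
  the carrier.
\<close>

definition is_principal_isotope ::
    "('a, 'm) monoid_scheme \<Rightarrow> 'a \<Rightarrow> 'a \<Rightarrow> ('a, 'n) monoid_scheme \<Rightarrow> bool"
  where "is_principal_isotope G f g H \<longleftrightarrow>
    loop H \<and> carrier H = carrier G \<and> f \<in> carrier G \<and> g \<in> carrier G \<and>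
    (\<forall>x\<in>carrier G. \<forall>y\<in>carrier G.
      right_trans G g x \<otimes>\<^bsub>H\<^esub> left_trans G f y = x \<otimes>\<^bsub>G\<^esub> y)"

text \<open>
  The elements \<open>f, g\<close> are existentially quantified: the same loop \<open>H\<close> may be a principal isotope
  of \<open>G\<close> for several pairs, and it suffices that one of them lies in an S-subloop.
\<close>

definition smarandache_principal_isotope ::
    "('a, 'm) monoid_scheme \<Rightarrow> ('a, 'n) monoid_scheme \<Rightarrow> bool"
  where "smarandache_principal_isotope G H \<longleftrightarrow>
    (\<exists>S f g. S_subloop S G \<and> f \<in> S \<and> g \<in> S \<and> is_principal_isotope G f g H)"

end

theory Submission
  imports Defs "HOL-Algebra.Coset"
begin

text \<open>
  For (1), pull the multiplication of an isotope \<open>H\<close> back to \<open>G\<close> along the third component of the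
  isotopism; this yields a principal isotope of \<open>G\<close> isomorphic to \<open>H\<close>. If \<open>f, g\<close> lie in an
  S-subloop \<open>S\<close> of \<open>G\<close>, then \<open>x \<mapsto> x \<oplus> (f \<oplus> g)\<close> is an isomorphism from the group \<open>S\<close> onto \<open>S\<close> with
  the multiplication of the \<open>f,g\<close>-principal isotope. For (2), any S-subloop works: in a group the
  triple reduces to \<open>(I, R\<^sub>h, R\<^sub>h)\<close> with \<open>h = g\<inverse> \<oplus> f\<inverse>\<close>.
\<close>

section \<open>Transport of loops and S-subloops along maps\<close>

lemma group_imp_loop:
  assumes "group G"
  shows "loop G"
proof -
  interpret group G by fact
  show ?thesis
  proof
    fix a b assume ab: "a \<in> carrier G" "b \<in> carrier G"
    show "\<exists>!x. x \<in> carrier G \<and> a \<otimes>\<^bsub>G\<^esub> x = b"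
      by (rule ex1I [of _ "inv\<^bsub>G\<^esub> a \<otimes>\<^bsub>G\<^esub> b"]) (use ab in \<open>auto simp flip: m_assoc\<close>)
    show "\<exists>!y. y \<in> carrier G \<and> y \<otimes>\<^bsub>G\<^esub> a = b"
      by (rule ex1I [of _ "b \<otimes>\<^bsub>G\<^esub> inv\<^bsub>G\<^esub> a"]) (use ab in \<open>auto simp: m_assoc\<close>)
  qed auto
qed

text \<open>An injective homomorphism is an isomorphism onto its image. \<open>one\<close> is asked
  for because a subloop of \<open>H\<close> inherits the unit of \<open>H\<close>, which therefore
  has to be the unit of the image.\<close>

lemma S_subloop_image:
  assumes G: "group G" and nontrivial: "\<exists>x\<in>carrier G. \<exists>y\<in>carrier G. x \<noteq> y"
    and sub: "h ` carrier G \<subseteq> carrier H" and inj: "inj_on h (carrier G)"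
    and mult: "\<And>x y. \<lbrakk>x \<in> carrier G; y \<in> carrier G\<rbrakk> \<Longrightarrow> h (x \<otimes>\<^bsub>G\<^esub> y) = h x \<otimes>\<^bsub>H\<^esub> h y"
    and one: "h \<one>\<^bsub>G\<^esub> = \<one>\<^bsub>H\<^esub>"
  shows "S_subloop (h ` carrier G) H"
proof -
  let ?M = "H\<lparr>carrier := h ` carrier G\<rparr>"
  have "h \<in> iso G ?M"
    using inj mult by (auto simp: iso_def hom_def bij_betw_def)
  \<comment> \<open>The image group comes with the image of the unit as its unit field; by
    \<open>one\<close> this update changes nothing.\<close>
  then have "group (?M\<lparr>one := h \<one>\<^bsub>G\<^esub>\<rparr>)"
    by (rule group.iso_imp_img_group [OF G])
  then have "group ?M"
    by (simp add: one)
  moreover have "\<exists>x\<in>h ` carrier G. \<exists>y\<in>h ` carrier G. x \<noteq> y"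
    using nontrivial inj by (auto dest: inj_onD)
  ultimately show ?thesis
    using sub by (simp add: S_subloop_def subloop_def group_imp_loop)
qed

text \<open>Since \<open>h\<close> is a bijection that turns products of \<open>K\<close> into
  products of \<open>H\<close>, identities can be checked after applying \<open>h\<close>, and the
  unique solution of an equation in \<open>H\<close> has a unique preimage in
  \<open>K\<close>.\<close>

lemma loop_pullback:
  assumes H: "loop H" and bij: "bij_betw h (carrier K) (carrier H)"
    and closed: "\<And>x y. \<lbrakk>x \<in> carrier K; y \<in> carrier K\<rbrakk> \<Longrightarrow> x \<otimes>\<^bsub>K\<^esub> y \<in> carrier K"
    and mult: "\<And>x y. \<lbrakk>x \<in> carrier K; y \<in> carrier K\<rbrakk> \<Longrightarrow> h (x \<otimes>\<^bsub>K\<^esub> y) = h x \<otimes>\<^bsub>H\<^esub> h y"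
    and one_closed: "\<one>\<^bsub>K\<^esub> \<in> carrier K" and one: "h \<one>\<^bsub>K\<^esub> = \<one>\<^bsub>H\<^esub>"
  shows "loop K"
proof -
  interpret H: loop H by fact
  have h: "h x \<in> carrier H" if "x \<in> carrier K" for x
    using bij that by (rule bij_betw_apply)
  have eqI: "x = y" if "h x = h y" "x \<in> carrier K" "y \<in> carrier K" for x y
    using bij that by (auto simp: bij_betw_def dest: inj_onD)
  have ex: "\<exists>x. x \<in> carrier K \<and> h x = z" if "z \<in> carrier H" for z
    using bij that by (metis bij_betw_def imageE)
  show ?thesis
  proof
    fix a b assume ab: "a \<in> carrier K" "b \<in> carrier K"
    show "\<exists>!x. x \<in> carrier K \<and> a \<otimes>\<^bsub>K\<^esub> x = b"
      using H.right_solvable [OF h h, OF ab] ab by (metis closed eqI ex h mult)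
    show "\<exists>!y. y \<in> carrier K \<and> y \<otimes>\<^bsub>K\<^esub> a = b"
      using H.left_solvable [OF h h, OF ab] ab by (metis closed eqI ex h mult)
  next
    fix x assume x: "x \<in> carrier K"
    show "\<one>\<^bsub>K\<^esub> \<otimes>\<^bsub>K\<^esub> x = x"
      using x by (intro eqI) (simp_all add: closed one_closed mult one h H.l_one)
    show "x \<otimes>\<^bsub>K\<^esub> \<one>\<^bsub>K\<^esub> = x"
      using x by (intro eqI) (simp_all add: closed one_closed mult one h H.r_one)
  qed (simp_all add: closed one_closed)
qed

text \<open>The restriction of \<open>h\<close> to an S-subloop of \<open>K\<close> embeds that
  group in \<open>H\<close>.\<close>

lemma smarandache_loop_image:
  assumes K: "smarandache_loop K" and H: "loop H" and h: "h \<in> iso K H" and one: "h \<one>\<^bsub>K\<^esub> = \<one>\<^bsub>H\<^esub>"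
  shows "smarandache_loop H"
proof -
  obtain S where S: "S \<subseteq> carrier K" "group (K\<lparr>carrier := S\<rparr>)" "\<exists>x\<in>S. \<exists>y\<in>S. x \<noteq> y"
    using K by (auto simp: smarandache_loop_def S_subloop_def subloop_def)
  have "S_subloop (h ` carrier (K\<lparr>carrier := S\<rparr>)) H"
  proof (rule S_subloop_image [OF S(2)])
    show "h ` carrier (K\<lparr>carrier := S\<rparr>) \<subseteq> carrier H" "inj_on h (carrier (K\<lparr>carrier := S\<rparr>))"
      using S(1) h by (auto simp: iso_def bij_betw_def intro: inj_on_subset)
    show "h (x \<otimes>\<^bsub>K\<lparr>carrier := S\<rparr>\<^esub> y) = h x \<otimes>\<^bsub>H\<^esub> h y"
      if "x \<in> carrier (K\<lparr>carrier := S\<rparr>)" "y \<in> carrier (K\<lparr>carrier := S\<rparr>)" for x y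
      using that S(1) h by (auto simp: iso_def intro: hom_mult)
  qed (use S(3) one in simp_all)
  then show ?thesis
    using H by (auto simp: smarandache_loop_def)
qed

section \<open>Principal isotopes\<close>

text \<open>On \<open>S\<close> the isotope multiplies by \<open>(x * inv g) * (inv f * y)\<close>.
  All these factors lie in a group, so associativity is available although \<open>G\<close> is only
  a loop. For \<open>x * u\<close> and \<open>y * u\<close> with \<open>u = f * g\<close>, the
  factor \<open>u * inv g = f\<close> cancels against \<open>inv f\<close>, which leaves
  \<open>(x * y) * u\<close>.\<close>

lemma smarandache_principal_isotope_imp_smarandache_loop:
  assumes G: "loop G" and iso: "smarandache_principal_isotope G H"
  shows "smarandache_loop H"
proof -
  interpret G: loop G by fact
  obtain S f g where S: "S_subloop S G" and fg: "f \<in> S" "g \<in> S"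
    and H: "is_principal_isotope G f g H"
    using iso by (auto simp: smarandache_principal_isotope_def)
  interpret H: loop H
    using H by (simp add: is_principal_isotope_def)
  define M where "M = G\<lparr>carrier := S\<rparr>"
  have M: "carrier M = S" "mult M = mult G" "\<one>\<^bsub>M\<^esub> = \<one>\<^bsub>G\<^esub>"
    by (simp_all add: M_def)
  have sub: "S \<subseteq> carrier G" and nontrivial: "\<exists>x\<in>S. \<exists>y\<in>S. x \<noteq> y"
    using S by (auto simp: S_subloop_def subloop_def)
  interpret M: group M
    using S by (simp add: S_subloop_def M_def)
  have carrier_H: "carrier H = carrier G"
    using H by (simp add: is_principal_isotope_def)
  have isotope: "(x \<otimes>\<^bsub>G\<^esub> g) \<otimes>\<^bsub>H\<^esub> (f \<otimes>\<^bsub>G\<^esub> y) = x \<otimes>\<^bsub>G\<^esub> y"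
    if "x \<in> carrier G" "y \<in> carrier G" for x y
    using H that by (simp add: is_principal_isotope_def right_trans_def left_trans_def)
  define u where "u = f \<otimes>\<^bsub>M\<^esub> g"
  have fgM: "f \<in> carrier M" "g \<in> carrier M"
    using fg by (simp_all add: M)
  have u: "u \<in> carrier M"
    using fgM by (simp add: u_def)
  \<comment> \<open>With \<open>x * g\<close> equal to the unit of \<open>H\<close>, the isotope
    equation at \<open>x\<close> and \<open>g\<close> says that this unit times \<open>u\<close> in
    \<open>H\<close> is again \<open>x * g\<close>. The left side is also \<open>u\<close>.\<close>
  have one: "u = \<one>\<^bsub>H\<^esub>"
  proof -
    obtain x where x: "x \<in> carrier G" "x \<otimes>\<^bsub>G\<^esub> g = \<one>\<^bsub>H\<^esub>"
      using G.left_solvable [of g "\<one>\<^bsub>H\<^esub>"] fg sub H.one_closed carrier_H by auto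
    have "\<one>\<^bsub>H\<^esub> = \<one>\<^bsub>H\<^esub> \<otimes>\<^bsub>H\<^esub> u"
      using isotope [of x g] x fg sub by (auto simp: u_def M)
    also have "\<dots> = u"
      using u sub by (intro H.l_one) (auto simp: M carrier_H)
    finally show ?thesis by simp
  qed
  have "S_subloop ((\<lambda>x. x \<otimes>\<^bsub>M\<^esub> u) ` carrier M) H"
  proof (rule S_subloop_image)
    show "group M" ..
    show "\<exists>x\<in>carrier M. \<exists>y\<in>carrier M. x \<noteq> y"
      using nontrivial by (simp add: M)
    have "(\<lambda>x. x \<otimes>\<^bsub>M\<^esub> u) ` carrier M \<subseteq> carrier M"
      using u by auto
    then show "(\<lambda>x. x \<otimes>\<^bsub>M\<^esub> u) ` carrier M \<subseteq> carrier H"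
      using sub by (simp add: M carrier_H)
    show "inj_on (\<lambda>x. x \<otimes>\<^bsub>M\<^esub> u) (carrier M)"
      using u by (auto intro: inj_onI)
    show "\<one>\<^bsub>M\<^esub> \<otimes>\<^bsub>M\<^esub> u = \<one>\<^bsub>H\<^esub>"
      using u one by simp
    fix x y assume xy: "x \<in> carrier M" "y \<in> carrier M"
    \<comment> \<open>\<open>z\<close> brings the second factor into the form \<open>f * z\<close>
      that the isotope equation expects; the first one is
      \<open>x * u = (x * f) * g\<close>.\<close>
    define z where "z = inv\<^bsub>M\<^esub> f \<otimes>\<^bsub>M\<^esub> (y \<otimes>\<^bsub>M\<^esub> u)"
    have z: "z \<in> carrier M" "f \<otimes>\<^bsub>M\<^esub> z = y \<otimes>\<^bsub>M\<^esub> u"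
      using xy u fgM by (auto simp: z_def simp flip: M.m_assoc)
    have "(x \<otimes>\<^bsub>M\<^esub> u) \<otimes>\<^bsub>H\<^esub> (y \<otimes>\<^bsub>M\<^esub> u) = ((x \<otimes>\<^bsub>M\<^esub> f) \<otimes>\<^bsub>M\<^esub> g) \<otimes>\<^bsub>H\<^esub> (f \<otimes>\<^bsub>M\<^esub> z)"
      unfolding z(2) using xy fgM by (simp add: u_def M.m_assoc)
    also have "\<dots> = (x \<otimes>\<^bsub>M\<^esub> f) \<otimes>\<^bsub>M\<^esub> z"
      using isotope [of "x \<otimes>\<^bsub>M\<^esub> f" z] M.m_closed [OF xy(1) fgM(1)] z(1) sub by (auto simp: M)
    also have "\<dots> = (x \<otimes>\<^bsub>M\<^esub> y) \<otimes>\<^bsub>M\<^esub> u"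
      using xy fgM z u by (simp add: M.m_assoc)
    finally show "(x \<otimes>\<^bsub>M\<^esub> y) \<otimes>\<^bsub>M\<^esub> u = (x \<otimes>\<^bsub>M\<^esub> u) \<otimes>\<^bsub>H\<^esub> (y \<otimes>\<^bsub>M\<^esub> u)"
      by simp
  qed
  then show ?thesis
    using H.loop_axioms by (auto simp: smarandache_loop_def)
qed

text \<open>Let \<open>f\<close> and \<open>g\<close> be the preimages of the unit of
  \<open>H\<close> under \<open>A\<close> and \<open>B\<close>. Then \<open>A\<close> is
  \<open>R_g\<close> followed by \<open>C\<close>, and \<open>B\<close> is \<open>L_f\<close>
  followed by \<open>C\<close>, so pulling the product of \<open>H\<close> back along
  \<open>C\<close> leaves exactly the \<open>f,g\<close>-principal isotope.\<close>

lemma isotope_isomorphic_principal_isotope: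
  fixes G :: "'a monoid" and H :: "'b monoid"
  assumes G: "loop G" and H: "loop H" and iso: "isotopism G H A B C"
  obtains K :: "'a monoid" and f g where "f \<in> carrier G" "g \<in> carrier G"
    "is_principal_isotope G f g K" "C \<in> iso K H" "C \<one>\<^bsub>K\<^esub> = \<one>\<^bsub>H\<^esub>"
proof -
  interpret G: loop G by fact
  interpret H: loop H by fact
  have bij: "bij_betw A (carrier G) (carrier H)" "bij_betw B (carrier G) (carrier H)"
      "bij_betw C (carrier G) (carrier H)"
    and ABC: "\<And>x y. \<lbrakk>x \<in> carrier G; y \<in> carrier G\<rbrakk> \<Longrightarrow> A x \<otimes>\<^bsub>H\<^esub> B y = C (x \<otimes>\<^bsub>G\<^esub> y)"
    using iso by (simp_all add: isotopism_def)
  have "\<one>\<^bsub>H\<^esub> \<in> A ` carrier G" "\<one>\<^bsub>H\<^esub> \<in> B ` carrier G"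
    using bij H.one_closed by (simp_all add: bij_betw_def)
  then obtain f g where f: "f \<in> carrier G" "A f = \<one>\<^bsub>H\<^esub>" and g: "g \<in> carrier G" "B g = \<one>\<^bsub>H\<^esub>"
    by force
  define D where "D = inv_into (carrier G) C"
  have D: "D z \<in> carrier G" "C (D z) = z" if "z \<in> carrier H" for z
    using that bij(3) by (auto simp: D_def bij_betw_def inv_into_into f_inv_into_f)
  have DC: "D (C x) = x" if "x \<in> carrier G" for x
    using that bij(3) by (simp add: D_def bij_betw_def)
  have C: "C x \<in> carrier H" if "x \<in> carrier G" for x
    using bij(3) that by (rule bij_betw_apply)
  \<comment> \<open>The unit is chosen as the preimage under \<open>C\<close> of the unit of
    \<open>H\<close>, so that \<open>C\<close> preserves units.\<close>
  define K where "K = \<lparr>carrier = carrier G, mult = \<lambda>x y. D (C x \<otimes>\<^bsub>H\<^esub> C y), one = D \<one>\<^bsub>H\<^esub>\<rparr>"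
  have K: "bij_betw C (carrier K) (carrier H)"
    "\<And>x y. \<lbrakk>x \<in> carrier K; y \<in> carrier K\<rbrakk> \<Longrightarrow> C (x \<otimes>\<^bsub>K\<^esub> y) = C x \<otimes>\<^bsub>H\<^esub> C y"
    "C \<one>\<^bsub>K\<^esub> = \<one>\<^bsub>H\<^esub>"
    using bij(3) by (simp_all add: K_def D C H.m_closed H.one_closed)
  have "loop K"
    by (rule loop_pullback [OF H K(1) _ K(2) _ K(3)])
      (simp_all add: K_def D C H.m_closed H.one_closed)
  moreover have "(x \<otimes>\<^bsub>G\<^esub> g) \<otimes>\<^bsub>K\<^esub> (f \<otimes>\<^bsub>G\<^esub> y) = x \<otimes>\<^bsub>G\<^esub> y" if "x \<in> carrier G" "y \<in> carrier G" for x y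
  proof -
    \<comment> \<open>In \<open>ABC\<close>, the choices \<open>y = g\<close> and
      \<open>x = f\<close> make one factor the unit of \<open>H\<close>.\<close>
    have "A x = C (x \<otimes>\<^bsub>G\<^esub> g)" "B y = C (f \<otimes>\<^bsub>G\<^esub> y)"
      using ABC [of x g] ABC [of f y] that f g bij(1,2)
      by (simp_all add: H.r_one H.l_one bij_betw_apply)
    then show ?thesis
      using ABC [OF that] that by (simp add: K_def DC G.m_closed)
  qed
  ultimately have "is_principal_isotope G f g K"
    using f g by (simp add: is_principal_isotope_def right_trans_def left_trans_def K_def)
  moreover have "C \<in> iso K H"
    using K by (auto simp: iso_def hom_def bij_betw_def)
  ultimately show thesis
    using that f g K(3) by blast
qed

text \<open>The isotope \<open>H\<close> may have elements of another type, but the principal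
  isotope isomorphic to it lives on the carrier of \<open>G\<close>. Hence \<open>principal\<close>
  only has to speak about loops over \<open>'a\<close>.\<close>

lemma smarandache_principal_isotopes_imp_universal:
  fixes G :: "'a monoid"
  assumes G: "smarandache_loop G"
    and principal: "\<And>f g (K :: 'a monoid). \<lbrakk>f \<in> carrier G; g \<in> carrier G; is_principal_isotope G f g K\<rbrakk>
      \<Longrightarrow> smarandache_principal_isotope G K"
  shows "universal_smarandache_loop TYPE('b) G"
  unfolding universal_smarandache_loop_def
proof (intro conjI allI impI G)
  fix H :: "'b monoid" assume H: "loop H \<and> isotopic G H"
  have loop: "loop G"
    using G by (simp add: smarandache_loop_def)
  obtain A B C where "isotopism G H A B C"
    using H by (auto simp: isotopic_def)
  then obtain K :: "'a monoid" and f g where fg: "f \<in> carrier G" "g \<in> carrier G"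
    and K: "is_principal_isotope G f g K" "C \<in> iso K H" "C \<one>\<^bsub>K\<^esub> = \<one>\<^bsub>H\<^esub>"
    by (rule isotope_isomorphic_principal_isotope [OF loop conjunct1 [OF H]])
  have "smarandache_loop K"
    using principal [OF fg K(1)] by (rule smarandache_principal_isotope_imp_smarandache_loop [OF loop])
  then show "smarandache_loop H"
    using H K(2,3) by (blast intro: smarandache_loop_image)
qed

section \<open>Translations and autotopisms in a group\<close>

lemma (in group) right_trans_inv_eq:
  assumes "g \<in> carrier G" "x \<in> carrier G"
  shows "right_trans_inv G g x = x \<otimes> inv g"
  unfolding right_trans_inv_def right_trans_def
  by (rule inv_into_f_eq) (use assms in \<open>auto simp: m_assoc intro: inj_onI\<close>)

lemma (in group) left_trans_inv_eq:
  assumes "f \<in> carrier G" "x \<in> carrier G"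
  shows "left_trans_inv G f x = inv f \<otimes> x"
  unfolding left_trans_inv_def left_trans_def
  by (rule inv_into_f_eq) (use assms in \<open>auto simp flip: m_assoc intro: inj_onI\<close>)

lemma (in group) right_inverse_eq:
  assumes "f \<in> carrier G"
  shows "right_inverse G f = inv f"
  unfolding right_inverse_def
  \<comment> \<open>What remains is uniqueness: if \<open>f * x\<close> is the unit, then
    \<open>inv x = f\<close>, and inverting gives \<open>x = inv f\<close>.\<close>
  by (rule the_equality) (use assms in \<open>simp_all add: r_inv\<close>, metis inv_equality inv_inv)

text \<open>The autotopism equation is associativity, \<open>x * (y * h) = (x * y) * h\<close>.
  \<open>B\<close> and \<open>C\<close> are prescribed only on the carrier, since maps built from
  \<open>inv_into\<close> are not controlled outside it.\<close>

lemma (in group) autotopism_right_trans: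
  assumes "h \<in> carrier G"
    and B: "\<And>x. x \<in> carrier G \<Longrightarrow> B x = x \<otimes> h" and C: "\<And>x. x \<in> carrier G \<Longrightarrow> C x = x \<otimes> h"
  shows "autotopism G id B C"
proof -
  have "bij_betw (\<lambda>x. x \<otimes> h) (carrier G) (carrier G)"
    by (rule bij_betw_byWitness [where f' = "\<lambda>x. x \<otimes> inv h"]) (use assms(1) in \<open>auto simp: m_assoc\<close>)
  then have "bij_betw B (carrier G) (carrier G)" "bij_betw C (carrier G) (carrier G)"
    using B C by (simp_all cong: bij_betw_cong)
  then show ?thesis
    using assms by (simp add: autotopism_def isotopism_def m_assoc)
qed

text \<open>By associativity left translations commute with right ones, so \<open>L_f\<close> and
  its inverse cancel in the second component. Both components become right translation by
  \<open>inv g * inv f\<close>.\<close>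

lemma (in group) principal_autotopism:
  assumes fg: "f \<in> carrier G" "g \<in> carrier G"
  shows "autotopism G id
    (left_trans G f \<circ>> right_trans_inv G g \<circ>> right_trans G (right_inverse G f) \<circ>> left_trans_inv G f)
    (right_trans_inv G g \<circ>> right_trans G (right_inverse G f))"
proof (rule autotopism_right_trans)
  show "inv g \<otimes> inv f \<in> carrier G"
    using fg by simp
  fix x assume x: "x \<in> carrier G"
  show "(right_trans_inv G g \<circ>> right_trans G (right_inverse G f)) x = x \<otimes> (inv g \<otimes> inv f)"
    using fg x by (simp add: fcomp_def right_trans_inv_eq right_inverse_eq right_trans_def m_assoc)
  \<comment> \<open>\<open>m_assoc\<close> nests products to the right, so the cancellation of
    \<open>f\<close> has to be supplied in this nested form.\<close>
  have "inv f \<otimes> (f \<otimes> y) = y" if "y \<in> carrier G" for y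
    using fg that by (simp flip: m_assoc)
  then show "(left_trans G f \<circ>> right_trans_inv G g \<circ>> right_trans G (right_inverse G f)
      \<circ>> left_trans_inv G f) x = x \<otimes> (inv g \<otimes> inv f)"
    using fg x by (simp add: fcomp_def right_trans_inv_eq left_trans_inv_eq right_inverse_eq
        right_trans_def left_trans_def m_assoc)
qed

theorem theorem3p2:
  fixes G :: "'a monoid"
  assumes "smarandache_loop G"
  shows "((\<forall>f\<in>carrier G. \<forall>g\<in>carrier G. \<forall>H :: 'a monoid.
            is_principal_isotope G f g H \<longrightarrow> smarandache_principal_isotope G H)
          \<longrightarrow> universal_smarandache_loop TYPE('b) G)
       \<and> (universal_smarandache_loop TYPE('a) G
          \<longrightarrow> (\<exists>S. S_subloop S G \<and>
                (\<forall>f\<in>S. \<forall>g\<in>S.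
                  let M = G\<lparr>carrier := S\<rparr>;
                      L = left_trans M f;
                      L' = left_trans_inv M f;
                      R' = right_trans_inv M g;
                      R\<^sub>\<rho> = right_trans M (right_inverse M f)
                  in autotopism M id (L \<circ>> R' \<circ>> R\<^sub>\<rho> \<circ>> L') (R' \<circ>> R\<^sub>\<rho>))))"
proof (intro conjI impI)
  assume "\<forall>f\<in>carrier G. \<forall>g\<in>carrier G. \<forall>H :: 'a monoid.
    is_principal_isotope G f g H \<longrightarrow> smarandache_principal_isotope G H"
  then show "universal_smarandache_loop TYPE('b) G"
    using assms by (blast intro: smarandache_principal_isotopes_imp_universal)
next
  obtain S where S: "S_subloop S G"
    using assms by (auto simp: smarandache_loop_def)
  then interpret M: group "G\<lparr>carrier := S\<rparr>"
    by (simp add: S_subloop_def)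
  show "\<exists>S. S_subloop S G \<and>
      (\<forall>f\<in>S. \<forall>g\<in>S.
        let M = G\<lparr>carrier := S\<rparr>;
            L = left_trans M f;
            L' = left_trans_inv M f;
            R' = right_trans_inv M g;
            R\<^sub>\<rho> = right_trans M (right_inverse M f)
        in autotopism M id (L \<circ>> R' \<circ>> R\<^sub>\<rho> \<circ>> L') (R' \<circ>> R\<^sub>\<rho>))"
    unfolding Let_def using S M.principal_autotopism by auto
qed

end
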